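(* Let $k\ge 0$ be an integer, let $\varepsilon(x,\xi),\rho(x,\xi)\in C^k(\mathbb{S}D)$ with $\varepsilon(x,\xi)\ge 0$, and put $\alpha=\varepsilon+\mathrm{i}\rho$. Let a (complex-valued) function $\varphi(t,x,\xi)\in C^{k+1}(\mathbb{R}\times\mathbb{S}D)$ be a solution of the equation $$\frac{1}{k!}\Big(\frac{\partial}{\partial t}+\mathcal{H}+\alpha\Big)^{k+1}\varphi=0$$ that satisfies the initial conditions $$\varphi(0,x,\xi)=\frac{\partial\varphi}{\partial t}(0,x,\xi)=\ldots=\frac{\partial^k\varphi}{\partial t^k}(0,x,\xi)=0,\qquad (x,\xi)\in\mathbb{S}D,$$ and, for $x\in\partial D$, $\langle n_x,\xi\rangle<0$, $t\ge 0$, the boundary conditions $$\varphi(t,x,\xi)=(\mathcal{H}\varphi)(t,x,\xi)=\ldots=(\mathcal{H}^k\varphi)(t,x,\xi)=0 ,$$ where $n_x$ is the outer normal to the surface $\partial D$ at the point $x$. Then $\varphi(t,x,\xi)=0$ for $t>0$, $(x,\xi)\in\mathbb{S}D$.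
   Context: $D\subset\mathbb{R}^3$ is a bounded convex domain with smooth boundary $\partial D$, $\mathbb{S}^2$ is the unit sphere of $\mathbb{R}^3$, and $\mathbb{S}D=\{(x,\xi): x\in D,\ \xi\in\mathbb{S}^2\}$. The functions $\varepsilon,\rho$ are real-valued and bounded. Functions of class $C^j(\mathbb{S}D)$ or $C^j(\mathbb{R}\times\mathbb{S}D)$ are understood to have their derivatives up to order $j$ continuous up to the boundary in $x$, so that the values on $x\in\partial D$ are defined. The operator $\mathcal{H}$ is $(\mathcal{H}\psi)(t,x,\xi)=\frac{d}{d\tau}\psi(t,x+\tau\xi,\xi)\big|_{\tau=0}=\sum_{j=1}^3\xi^j\frac{\partial\psi}{\partial x^j}(t,x,\xi)$; $\mathcal{H}^j$ denotes its $j$-th power, and $\alpha$ acts by multiplication. *)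

theory Defs
  imports "HOL-Analysis.Analysis"
begin

type_synonym vec3 = "real^3"

abbreviation S2 :: "vec3 set" where
  "S2 \<equiv> sphere 0 1"


text \<open>
  For an open set \<open>U\<close> and \<open>U \<subseteq> V \<subseteq> closure U\<close>: \<open>f\<close> is of class C^j on \<open>U\<close>, and all its partial
  derivatives of order at most \<open>j\<close> extend continuously to \<open>V\<close>.  Only the values of \<open>f\<close> on \<open>U\<close> matter.
\<close>

primrec Ck_upto :: "nat \<Rightarrow> 'a set \<Rightarrow> 'a set \<Rightarrow> ('a::euclidean_space \<Rightarrow> 'b::real_normed_vector) \<Rightarrow> bool"
where
  "Ck_upto 0 U V f \<longleftrightarrow> (\<exists>g. continuous_on V g \<and> (\<forall>p\<in>U. g p = f p))"
| "Ck_upto (Suc j) U V f \<longleftrightarrow>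
     (\<exists>g. continuous_on V g \<and> (\<forall>p\<in>U. g p = f p)) \<and>
     (\<forall>p\<in>U. f differentiable (at p)) \<and>
     (\<forall>b\<in>Basis. Ck_upto j U V (\<lambda>p. frechet_derivative f (at p) b))"

definition smooth_on_open :: "'a set \<Rightarrow> ('a::euclidean_space \<Rightarrow> 'b::real_normed_vector) \<Rightarrow> bool" where
  "smooth_on_open U f \<longleftrightarrow> (\<forall>j. Ck_upto j U U f)"

text \<open>
  The unit sphere has no interior, so smoothness in the direction variable is expressed through the
  extension that is homogeneous of degree 0, that is \<open>f x (\<xi> / norm \<xi>)\<close> for \<open>\<xi> \<noteq> 0\<close>
  (\<open>sgn \<xi>\<close> is \<open>\<xi> / norm \<xi>\<close>).  As \<open>sgn\<close> is a smooth retraction of the punctured space onto the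
  sphere, this is C^j regularity on the manifold \<open>D \<times> S2\<close>, with derivatives continuous up to
  the boundary in \<open>x\<close>.
\<close>

definition Ck_SD :: "nat \<Rightarrow> vec3 set \<Rightarrow> (vec3 \<Rightarrow> vec3 \<Rightarrow> 'b::real_normed_vector) \<Rightarrow> bool" where
  "Ck_SD j D f \<longleftrightarrow>
     Ck_upto j (D \<times> (- {0})) (closure D \<times> (- {0})) (\<lambda>(x, \<xi>). f x (sgn \<xi>))"

definition Ck_RSD :: "nat \<Rightarrow> vec3 set \<Rightarrow> (real \<Rightarrow> vec3 \<Rightarrow> vec3 \<Rightarrow> 'b::real_normed_vector) \<Rightarrow> bool" where
  "Ck_RSD j D f \<longleftrightarrow>
     Ck_upto j (UNIV \<times> D \<times> (- {0})) (UNIV \<times> closure D \<times> (- {0})) (\<lambda>(t, x, \<xi>). f t x (sgn \<xi>))"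


text \<open>
  \<open>r\<close> describes \<open>D\<close> near the boundary point \<open>p\<close> as the sublevel set \<open>r < 0\<close>; since the gradient of
  \<open>r\<close> does not vanish on \<open>U\<close>, the boundary of \<open>D\<close> in \<open>U\<close> is the regular level set \<open>r = 0\<close>
  and the gradient of \<open>r\<close> points out of \<open>D\<close> there.
\<close>

definition local_defining_function :: "vec3 set \<Rightarrow> vec3 \<Rightarrow> vec3 set \<Rightarrow> (vec3 \<Rightarrow> real) \<Rightarrow> bool" where
  "local_defining_function D p U r \<longleftrightarrow>
     open U \<and> p \<in> U \<and> smooth_on_open U r \<and>
     (\<forall>y\<in>U. \<exists>g. GDERIV r y :> g \<and> g \<noteq> 0) \<and>
     D \<inter> U = {y \<in> U. r y < 0}"

definition smooth_boundary :: "vec3 set \<Rightarrow> bool" where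
  "smooth_boundary D \<longleftrightarrow> (\<forall>p\<in>frontier D. \<exists>U r. local_defining_function D p U r)"

text \<open>The normalized gradient does not depend on the choice of the local defining function.\<close>

definition outer_normal :: "vec3 set \<Rightarrow> vec3 \<Rightarrow> vec3" where
  "outer_normal D x =
     (THE n. \<exists>U r g. local_defining_function D x U r \<and> GDERIV r x :> g \<and> n = sgn g)"


definition time_deriv ::
  "(real \<Rightarrow> vec3 \<Rightarrow> vec3 \<Rightarrow> complex) \<Rightarrow> real \<Rightarrow> vec3 \<Rightarrow> vec3 \<Rightarrow> complex" where
  "time_deriv \<psi> t x \<xi> = vector_derivative (\<lambda>s. \<psi> s x \<xi>) (at t)"

definition ray_deriv ::
  "(real \<Rightarrow> vec3 \<Rightarrow> vec3 \<Rightarrow> complex) \<Rightarrow> real \<Rightarrow> vec3 \<Rightarrow> vec3 \<Rightarrow> complex" where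
  "ray_deriv \<psi> t x \<xi> = vector_derivative (\<lambda>\<tau>. \<psi> t (x + \<tau> *\<^sub>R \<xi>) \<xi>) (at 0)"

definition transport_op ::
  "(vec3 \<Rightarrow> vec3 \<Rightarrow> complex) \<Rightarrow>
   (real \<Rightarrow> vec3 \<Rightarrow> vec3 \<Rightarrow> complex) \<Rightarrow> real \<Rightarrow> vec3 \<Rightarrow> vec3 \<Rightarrow> complex" where
  "transport_op \<alpha> \<psi> t x \<xi> = time_deriv \<psi> t x \<xi> + ray_deriv \<psi> t x \<xi> + \<alpha> x \<xi> * \<psi> t x \<xi>"

text \<open>
  A function on \<open>D\<close> whose derivatives are continuous up to the boundary takes its value at a boundary
  point by continuous extension, that is as the limit from inside \<open>D\<close>.
\<close>

definition boundary_value ::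
  "vec3 set \<Rightarrow> (real \<Rightarrow> vec3 \<Rightarrow> vec3 \<Rightarrow> complex) \<Rightarrow> real \<Rightarrow> vec3 \<Rightarrow> vec3 \<Rightarrow> complex" where
  "boundary_value D \<psi> t x \<xi> = Lim (at x within D) (\<lambda>y. \<psi> t y \<xi>)"

end

theory Submission
  imports Defs
begin

text \<open>
  On the characteristic line \<open>s \<mapsto> (t\<^sub>0 + s, x\<^sub>0 + s \<xi>)\<close> the operator \<open>\<partial>\<^sub>t + H + \<alpha>\<close> acts as the ordinary
  differential operator \<open>d/ds + \<alpha>\<close>. After multiplication by the integrating factor
  \<open>E(s) = exp \<integral> \<alpha>\<close> the equation says that the derivative of order \<open>k + 1\<close> of
  \<open>E(s) \<phi>(t\<^sub>0 + s, x\<^sub>0 + s \<xi>, \<xi>)\<close> vanishes, so that this function is a polynomial in \<open>s\<close> of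
  degree at most \<open>k\<close>. Hence \<open>\<phi>\<close> vanishes along the line as soon as \<open>\<phi> = O(s^(k+1))\<close> for \<open>s \<rightarrow> 0\<close>,
  since \<open>E\<close> stays bounded (\<open>transport_solution_zero_along_characteristic\<close>).

  Followed backwards in time, the characteristic through \<open>(t, x)\<close> either reaches time \<open>0\<close> inside
  \<open>D\<close>, or meets the boundary at some time \<open>t\<^sub>0 \<ge> 0\<close> (\<open>backward_ray_cases\<close>). These two cases
  determine the base point \<open>(t\<^sub>0, x\<^sub>0)\<close>, and in each of them a Taylor estimate in one variable
  gives the bound \<open>O(s^(k+1))\<close>:
  in the first case \<open>\<phi>\<close> is expanded in \<open>t\<close> at \<open>t = 0\<close>, with the space point \<open>x\<^sub>0 + s \<xi>\<close> held fixed
  (\<open>small_near_initial_time\<close>); in the second it is expanded along the ray at \<open>x\<^sub>0\<close>, with the time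
  \<open>t\<^sub>0 + s\<close> held fixed (\<open>small_near_inflow_boundary\<close>). The error terms are uniform because the
  derivatives of order \<open>k + 1\<close> are continuous up to the boundary. As the two estimates use only
  pure time derivatives or pure ray derivatives, no information on mixed derivatives at the
  base point has to be extracted from the data.

  In the second case \<open>\<xi>\<close> points into \<open>D\<close> at \<open>x\<^sub>0\<close>. By convexity the gradient of a local defining
  function at \<open>x\<^sub>0\<close> is the normal of a supporting half-space, and as \<open>D\<close> is open the inequality
  \<open>\<langle>n, \<xi>\<rangle> < 0\<close> is strict (\<open>outer_normal_inner_neg\<close>), so the boundary condition applies at \<open>x\<^sub>0\<close>.
\<close>

section \<open>Functions whose derivatives extend continuously\<close>

lemma Ck_upto_extension:
  assumes "Ck_upto j U V f"
  obtains g where "continuous_on V g" "\<And>p. p \<in> U \<Longrightarrow> g p = f p"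
  using assms by (cases j) (simp_all, blast+)

lemma Ck_upto_SucI:
  assumes "Ck_upto 0 U V f"
    and "\<And>p. p \<in> U \<Longrightarrow> (f has_derivative f' p) (at p)"
    and "\<And>b. b \<in> Basis \<Longrightarrow> Ck_upto j U V (\<lambda>p. frechet_derivative f (at p) b)"
  shows "Ck_upto (Suc j) U V f"
  using assms unfolding Ck_upto.simps differentiable_def by blast

lemma Ck_upto_SucD:
  assumes "Ck_upto (Suc j) U V f"
  shows "Ck_upto 0 U V f"
    and "b \<in> Basis \<Longrightarrow> Ck_upto j U V (\<lambda>p. frechet_derivative f (at p) b)"
  using assms unfolding Ck_upto.simps by blast+

lemma Ck_upto_0_cong:
  assumes "\<And>p. p \<in> U \<Longrightarrow> f p = g p" "Ck_upto 0 U V f"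
  shows "Ck_upto 0 U V g"
  using assms unfolding Ck_upto.simps by metis

lemma Ck_upto_has_derivative:
  assumes "Ck_upto (Suc j) U V f" "p \<in> U"
  shows "(f has_derivative frechet_derivative f (at p)) (at p)"
  using assms unfolding Ck_upto.simps frechet_derivative_works[symmetric] by blast

declare Ck_upto.simps [simp del]

lemma Ck_upto_cong:
  assumes "open U" "\<And>p. p \<in> U \<Longrightarrow> f p = g p" "Ck_upto j U V f"
  shows "Ck_upto j U V g"
  using assms(2,3)
proof (induction j arbitrary: f g)
  case 0
  then show ?case using Ck_upto_0_cong by metis
next
  case (Suc j)
  have d: "(g has_derivative frechet_derivative f (at p)) (at p)" if "p \<in> U" for p
    using has_derivative_transform_within_open[OF Ck_upto_has_derivative[OF Suc.prems(2) that] \<open>open U\<close> that]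
      Suc.prems(1) by auto
  show ?case
  proof (rule Ck_upto_SucI)
    show "Ck_upto 0 U V g" using Ck_upto_0_cong[OF Suc.prems(1) Ck_upto_SucD(1)[OF Suc.prems(2)]] .
    show "(g has_derivative frechet_derivative f (at p)) (at p)" if "p \<in> U" for p
      using d that .
    fix b :: 'a assume "b \<in> Basis"
    then show "Ck_upto j U V (\<lambda>p. frechet_derivative g (at p) b)"
      using Suc.prems(2)
      by - (rule Suc.IH[of "\<lambda>p. frechet_derivative f (at p) b"],
          simp_all add: frechet_derivative_at[OF d, symmetric] Ck_upto_SucD(2))
  qed
qed

text \<open>
  Induction steps go through this form: any explicit formula for the derivative can be used,
  since the class only depends on the values on the open set \<open>U\<close>.
\<close>

lemma Ck_upto_Suc_of_derivative:
  assumes "open U" "Ck_upto 0 U V f"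
    and d: "\<And>p. p \<in> U \<Longrightarrow> (f has_derivative f' p) (at p)"
    and "\<And>b. b \<in> Basis \<Longrightarrow> Ck_upto j U V (\<lambda>p. f' p b)"
  shows "Ck_upto (Suc j) U V f"
proof (rule Ck_upto_SucI[OF assms(2) d])
  fix b :: 'a assume "b \<in> Basis"
  then show "Ck_upto j U V (\<lambda>p. frechet_derivative f (at p) b)"
    by - (rule Ck_upto_cong[OF \<open>open U\<close> _ assms(4)],
        simp_all add: frechet_derivative_at[OF d, symmetric])
qed

lemma Ck_upto_Suc_imp: "Ck_upto (Suc j) U V f \<Longrightarrow> Ck_upto j U V f"
proof (induction j arbitrary: f)
  case 0
  then show ?case by (rule Ck_upto_SucD)
next
  case (Suc j)
  show ?case
    by (rule Ck_upto_SucI[OF Ck_upto_SucD(1)[OF Suc.prems] Ck_upto_has_derivative[OF Suc.prems]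
          Suc.IH[OF Ck_upto_SucD(2)[OF Suc.prems]]])
qed

lemma Ck_upto_mono: "Ck_upto j U V f \<Longrightarrow> i \<le> j \<Longrightarrow> Ck_upto i U V f"
  by (induction j) (auto simp: le_Suc_eq dest: Ck_upto_Suc_imp)

lemma Ck_upto_0_const: "Ck_upto 0 U V (\<lambda>_. c)"
  by (auto simp: Ck_upto.simps intro!: exI[of _ "\<lambda>_. c"])

lemma Ck_upto_const: "open U \<Longrightarrow> Ck_upto j U V (\<lambda>_. c)"
proof (induction j arbitrary: c)
  case 0
  show ?case by (rule Ck_upto_0_const)
next
  case (Suc j)
  show ?case
    by (rule Ck_upto_Suc_of_derivative[where f' = "\<lambda>_ _. 0"]) (auto intro: Suc Ck_upto_0_const)
qed

lemma Ck_upto_0_add: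
  assumes "Ck_upto 0 U V f" "Ck_upto 0 U V g"
  shows "Ck_upto 0 U V (\<lambda>p. f p + g p)"
proof -
  obtain f' g' where "continuous_on V f'" "\<And>p. p \<in> U \<Longrightarrow> f' p = f p"
    "continuous_on V g'" "\<And>p. p \<in> U \<Longrightarrow> g' p = g p"
    using Ck_upto_extension[OF assms(1)] Ck_upto_extension[OF assms(2)] by metis
  then show ?thesis
    by (auto simp: Ck_upto.simps intro!: exI[of _ "\<lambda>p. f' p + g' p"] continuous_on_add)
qed

lemma Ck_upto_add:
  assumes "open U" "Ck_upto j U V f" "Ck_upto j U V g"
  shows "Ck_upto j U V (\<lambda>p. f p + g p)"
  using assms(2,3)
proof (induction j arbitrary: f g)
  case 0
  then show ?case by (rule Ck_upto_0_add)
next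
  case (Suc j)
  show ?case
    by (rule Ck_upto_Suc_of_derivative[OF \<open>open U\<close> Ck_upto_0_add
          has_derivative_add[OF Suc.prems[THEN Ck_upto_has_derivative]] Suc.IH])
      (use Suc.prems[THEN Ck_upto_SucD(1)] Suc.prems[THEN Ck_upto_SucD(2)] in simp_all)
qed

lemma Ck_upto_sum:
  assumes "open U" "finite I" "\<And>i. i \<in> I \<Longrightarrow> Ck_upto j U V (f i)"
  shows "Ck_upto j U V (\<lambda>p. \<Sum>i\<in>I. f i p)"
  using assms(2,3)
  by (induction) (auto intro!: Ck_upto_add Ck_upto_const assms(1))

lemma Ck_upto_0_linear:
  assumes "bounded_linear h" "Ck_upto 0 U V f"
  shows "Ck_upto 0 U V (\<lambda>p. h (f p))"
proof -
  obtain f' where "continuous_on V f'" "\<And>p. p \<in> U \<Longrightarrow> f' p = f p"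
    using Ck_upto_extension[OF assms(2)] by metis
  then show ?thesis
    by (auto simp: Ck_upto.simps intro!: exI[of _ "\<lambda>p. h (f' p)"]
          bounded_linear.continuous_on[OF assms(1)])
qed

lemma Ck_upto_linear:
  assumes "open U" "bounded_linear h" "Ck_upto j U V f"
  shows "Ck_upto j U V (\<lambda>p. h (f p))"
  using assms(3)
proof (induction j arbitrary: f)
  case 0
  then show ?case by (rule Ck_upto_0_linear[OF assms(2)])
next
  case (Suc j)
  show ?case
  proof (rule Ck_upto_Suc_of_derivative[OF \<open>open U\<close> Ck_upto_0_linear[OF assms(2) Ck_upto_SucD(1)[OF Suc.prems]]])
    show "((\<lambda>p. h (f p)) has_derivative (\<lambda>v. h (frechet_derivative f (at p) v))) (at p)"
      if "p \<in> U" for p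
      using bounded_linear.has_derivative[OF assms(2) Ck_upto_has_derivative[OF Suc.prems that]] .
  qed (rule Suc.IH[OF Ck_upto_SucD(2)[OF Suc.prems]])
qed

lemma Ck_upto_0_mult:
  fixes f g :: "'a::euclidean_space \<Rightarrow> 'b::real_normed_algebra"
  assumes "Ck_upto 0 U V f" "Ck_upto 0 U V g"
  shows "Ck_upto 0 U V (\<lambda>p. f p * g p)"
proof -
  obtain f' g' where "continuous_on V f'" "\<And>p. p \<in> U \<Longrightarrow> f' p = f p"
    "continuous_on V g'" "\<And>p. p \<in> U \<Longrightarrow> g' p = g p"
    using Ck_upto_extension[OF assms(1)] Ck_upto_extension[OF assms(2)] by metis
  then show ?thesis
    by (auto simp: Ck_upto.simps intro!: exI[of _ "\<lambda>p. f' p * g' p"] continuous_on_mult)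
qed

lemma Ck_upto_mult:
  fixes f g :: "'a::euclidean_space \<Rightarrow> 'b::real_normed_algebra"
  assumes "open U" "Ck_upto j U V f" "Ck_upto j U V g"
  shows "Ck_upto j U V (\<lambda>p. f p * g p)"
  using assms(2,3)
proof (induction j arbitrary: f g)
  case 0
  then show ?case by (rule Ck_upto_0_mult)
next
  case (Suc j)
  show ?case
  proof (rule Ck_upto_Suc_of_derivative[OF \<open>open U\<close> Ck_upto_0_mult[OF Suc.prems[THEN Ck_upto_SucD(1)]]])
    show "((\<lambda>p. f p * g p) has_derivative (\<lambda>v. f p * frechet_derivative g (at p) v
        + frechet_derivative f (at p) v * g p)) (at p)" if "p \<in> U" for p
      using has_derivative_mult[OF Suc.prems[THEN Ck_upto_has_derivative, OF that]] .
    fix b :: 'a assume "b \<in> Basis"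
    with Suc.prems have "Ck_upto j U V (\<lambda>p. frechet_derivative f (at p) b)"
       "Ck_upto j U V (\<lambda>p. frechet_derivative g (at p) b)"
      by (simp_all add: Ck_upto_SucD(2))
    with Suc.prems show "Ck_upto j U V (\<lambda>p. f p * frechet_derivative g (at p) b
        + frechet_derivative f (at p) b * g p)"
      by (intro Ck_upto_add Suc.IH \<open>open U\<close> Suc.prems[THEN Ck_upto_Suc_imp])
  qed
qed

lemma Ck_upto_directional:
  assumes "open U" "Ck_upto (Suc j) U V f"
  shows "Ck_upto j U V (\<lambda>p. frechet_derivative f (at p) v)"
proof (rule Ck_upto_cong[OF \<open>open U\<close>])
  show "Ck_upto j U V (\<lambda>p. \<Sum>b\<in>Basis. (v \<bullet> b) *\<^sub>R frechet_derivative f (at p) b)"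
    by (rule Ck_upto_sum[OF \<open>open U\<close> finite_Basis Ck_upto_linear[OF \<open>open U\<close>
            bounded_linear_scaleR_right Ck_upto_SucD(2)[OF assms(2)]]])
  fix p assume "p \<in> U"
  then interpret bounded_linear "frechet_derivative f (at p)"
    using Ck_upto_has_derivative[OF assms(2)] has_derivative_bounded_linear by blast
  show "(\<Sum>b\<in>Basis. (v \<bullet> b) *\<^sub>R frechet_derivative f (at p) b) = frechet_derivative f (at p) v"
    by (subst (2) euclidean_representation[of v, symmetric]) (simp add: sum scaleR)
qed

lemma Ck_upto_0_compose_affine:
  assumes "bounded_linear l" "\<And>p. p \<in> U' \<Longrightarrow> c + l p \<in> U"
    "\<And>p. p \<in> V' \<Longrightarrow> c + l p \<in> V" "Ck_upto 0 U V f"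
  shows "Ck_upto 0 U' V' (\<lambda>p. f (c + l p))"
proof -
  obtain g where g: "continuous_on V g" "\<And>p. p \<in> U \<Longrightarrow> g p = f p"
    using Ck_upto_extension[OF assms(4)] by metis
  have "continuous_on V' (\<lambda>p. g (c + l p))"
    by (rule continuous_on_compose2[OF g(1)])
      (use assms(3) in \<open>auto intro!: continuous_intros bounded_linear.continuous_on[OF assms(1)]\<close>)
  then show ?thesis
    using g assms(2) unfolding Ck_upto.simps by blast
qed

text \<open>
  By the chain rule the partial derivatives of \<open>f (c + l p)\<close> are directional derivatives of \<open>f\<close> in
  the directions \<open>l b\<close>, and these are again composed with the same affine map.
\<close>

lemma Ck_upto_compose_affine:
  fixes l :: "'a::euclidean_space \<Rightarrow> 'b::euclidean_space"
  assumes "open U'" "bounded_linear l" "\<And>p. p \<in> U' \<Longrightarrow> c + l p \<in> U"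
    "\<And>p. p \<in> V' \<Longrightarrow> c + l p \<in> V" "open U" "Ck_upto j U V f"
  shows "Ck_upto j U' V' (\<lambda>p. f (c + l p))"
  using assms(6)
proof (induction j arbitrary: f)
  case 0
  show ?case by (rule Ck_upto_0_compose_affine[OF assms(2-4) 0])
next
  case (Suc j)
  show ?case
  proof (rule Ck_upto_Suc_of_derivative[OF \<open>open U'\<close>
        Ck_upto_0_compose_affine[OF assms(2-4) Ck_upto_SucD(1)[OF Suc.prems]]])
    show "((\<lambda>p. f (c + l p)) has_derivative (\<lambda>v. frechet_derivative f (at (c + l p)) (l v))) (at p)"
      if "p \<in> U'" for p
    proof -
      have "((\<lambda>p. c + l p) has_derivative (\<lambda>v. 0 + l v)) (at p)"
        by (intro has_derivative_add has_derivative_const bounded_linear_imp_has_derivative assms(2))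
      from has_derivative_compose[OF this Ck_upto_has_derivative[OF Suc.prems assms(3)[OF that]]]
      show ?thesis by simp
    qed
    show "Ck_upto j U' V' (\<lambda>p. frechet_derivative f (at (c + l p)) (l b))" for b
      using Suc.IH[OF Ck_upto_directional[OF \<open>open U\<close> Suc.prems]] .
  qed
qed

section \<open>Vanishing derivatives and smallness at an end point\<close>

text \<open>
  Integration raises the degree by one in each step: once \<open>h 1\<close> is a polynomial, \<open>h 0\<close> differs from
  its termwise antiderivative by a constant.
\<close>

lemma iterated_derivative_zero_imp_polynomial:
  fixes h :: "nat \<Rightarrow> real \<Rightarrow> complex"
  assumes "\<And>j s. j < n \<Longrightarrow> s \<in> {0<..<b} \<Longrightarrow> (h j has_vector_derivative h (Suc j) s) (at s)"
    and "\<And>s. s \<in> {0<..<b} \<Longrightarrow> h n s = 0"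
  shows "\<exists>c. \<forall>s\<in>{0<..<b}. h 0 s = (\<Sum>i<n. c i * of_real s ^ i)"
  using assms
proof (induction n arbitrary: h)
  case 0
  then show ?case by simp
next
  case (Suc n)
  obtain c where c: "\<And>s. s \<in> {0<..<b} \<Longrightarrow> h (Suc 0) s = (\<Sum>i<n. c i * of_real s ^ i)"
    using Suc.IH[of "\<lambda>j. h (Suc j)"] Suc.prems by auto
  define P where "P s = (\<Sum>i<n. c i / of_nat (Suc i) * of_real s ^ Suc i)" for s
  have P: "(P has_vector_derivative (\<Sum>i<n. c i * of_real s ^ i)) (at s)" for s
    unfolding P_def
  proof (rule has_vector_derivative_sum)
    fix i
    have "((\<lambda>z. c i / of_nat (Suc i) * z ^ Suc i) has_field_derivative
        c i / of_nat (Suc i) * (of_nat (Suc i) * of_real s ^ i)) (at (of_real s))"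
      using DERIV_power_Suc[OF DERIV_ident, of i "of_real s" UNIV]
      by (intro DERIV_cmult) simp
    then have "((\<lambda>z. c i / of_nat (Suc i) * z ^ Suc i) has_field_derivative c i * of_real s ^ i)
        (at (of_real s))"
      by (simp del: of_nat_Suc)
    then show "((\<lambda>s. c i / of_nat (Suc i) * of_real s ^ Suc i) has_vector_derivative
        c i * of_real s ^ i) (at s)"
      by (rule has_vector_derivative_real_field)
  qed
  have "((\<lambda>s. h 0 s - P s) has_vector_derivative 0) (at s within {0<..<b})"
    if s: "s \<in> {0<..<b}" for s
    using has_vector_derivative_diff[OF Suc.prems(1)[OF zero_less_Suc s] P[of s]]
    by (auto simp: c[OF s] intro: has_vector_derivative_at_within)
  then obtain d where d: "\<And>s. s \<in> {0<..<b} \<Longrightarrow> h 0 s - P s = d"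
    using has_vector_derivative_zero_constant[of "{0<..<b}" "\<lambda>s. h 0 s - P s"] by auto
  have "h 0 s = (\<Sum>i<Suc n. (case i of 0 \<Rightarrow> d | Suc i \<Rightarrow> c i / of_nat (Suc i)) * of_real s ^ i)"
    if "s \<in> {0<..<b}" for s
    unfolding sum.lessThan_Suc_shift using d[OF that] by (simp add: P_def algebra_simps)
  then show ?case
    by (intro exI[of _ "\<lambda>i. case i of 0 \<Rightarrow> d | Suc i \<Rightarrow> c i / of_nat (Suc i)"]) simp
qed

text \<open>
  Letting \<open>s\<close> tend to \<open>0\<close> shows that the constant coefficient vanishes; dividing by \<open>s\<close> then lowers
  both the degree and the exponent of the bound.
\<close>

lemma polynomial_small_at_0_imp_zero:
  fixes c :: "nat \<Rightarrow> complex"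
  assumes "0 < b" "\<And>s. s \<in> {0<..<b} \<Longrightarrow> norm (\<Sum>i<n. c i * of_real s ^ i) \<le> C * s ^ n"
  shows "\<forall>s. (\<Sum>i<n. c i * of_real s ^ i) = 0"
  using assms(2)
proof (induction n arbitrary: c)
  case 0
  then show ?case by simp
next
  case (Suc n)
  let ?p = "\<lambda>s::real. \<Sum>i<Suc n. c i * of_real s ^ i"
  let ?q = "\<lambda>s::real. \<Sum>i<n. c (Suc i) * of_real s ^ i"
  have p: "?p s = c 0 + of_real s * ?q s" for s
    unfolding sum.lessThan_Suc_shift by (simp add: sum_distrib_left algebra_simps)
  have "c 0 = 0"
  proof -
    have "((\<lambda>s. c 0 + of_real s * ?q s) \<longlongrightarrow> c 0 + of_real 0 * ?q 0) (at_right 0)"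
      by (intro tendsto_intros)
    then have 1: "((\<lambda>s. norm (?p s)) \<longlongrightarrow> norm (c 0)) (at_right 0)"
      unfolding p using tendsto_norm by fastforce
    have "((\<lambda>s::real. C * s ^ Suc n) \<longlongrightarrow> C * 0 ^ Suc n) (at_right 0)"
      by (intro tendsto_intros)
    then have 2: "((\<lambda>s::real. C * s ^ Suc n) \<longlongrightarrow> 0) (at_right 0)" by simp
    have "norm (c 0) \<le> 0"
      by (rule tendsto_le[OF _ 2 1]) (use Suc.prems eventually_at_right_real[OF \<open>0 < b\<close>] in
          \<open>auto elim!: eventually_mono simp del: sum.lessThan_Suc\<close>)
    then show ?thesis by simp
  qed
  moreover have "norm (?q s) \<le> C * s ^ n" if s: "s \<in> {0<..<b}" for s
  proof -
    have "s * norm (?q s) = norm (?p s)"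
      unfolding p \<open>c 0 = 0\<close> using s by (simp add: norm_mult)
    also have "\<dots> \<le> s * (C * s ^ n)" using Suc.prems[OF s] by (simp add: mult_ac)
    finally show ?thesis using s by simp
  qed
  then have "\<forall>s. ?q s = 0" by (rule Suc.IH)
  ultimately show ?case unfolding p by simp
qed

lemma iterated_derivative_zero_and_small_imp_zero:
  fixes h :: "nat \<Rightarrow> real \<Rightarrow> complex"
  assumes "\<And>j s. j < n \<Longrightarrow> s \<in> {0<..<b} \<Longrightarrow> (h j has_vector_derivative h (Suc j) s) (at s)"
    and "\<And>s. s \<in> {0<..<b} \<Longrightarrow> h n s = 0"
    and "\<And>s. s \<in> {0<..<b} \<Longrightarrow> norm (h 0 s) \<le> C * s ^ n"
    and "s \<in> {0<..<b}"
  shows "h 0 s = 0"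
proof -
  obtain c where c: "\<And>s. s \<in> {0<..<b} \<Longrightarrow> h 0 s = (\<Sum>i<n. c i * of_real s ^ i)"
    using iterated_derivative_zero_imp_polynomial[where h = h and n = n and b = b, OF assms(1,2)] by blast
  have "norm (\<Sum>i<n. c i * of_real r ^ i) \<le> C * r ^ n" if "r \<in> {0<..<b}" for r
    using assms(3)[OF that] unfolding c[OF that] .
  moreover have "0 < b" using assms(4) by auto
  ultimately have "(\<Sum>i<n. c i * of_real s ^ i) = 0"
    using polynomial_small_at_0_imp_zero[where b = b and n = n and c = c and C = C] by blast
  then show ?thesis using c[OF assms(4)] by simp
qed

text \<open>
  Taylor's estimate at an end point where \<open>f\<close> need not be defined and the derivatives vanish only
  as one-sided limits, as is the case for boundary values. Each integration is a mean value
  estimate on \<open>[r, s]\<close> followed by the limit \<open>r \<rightarrow> 0\<close>; the factor \<open>1 / n!\<close> is given away.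
\<close>

lemma norm_le_power_of_vanishing_derivatives:
  fixes f :: "nat \<Rightarrow> real \<Rightarrow> complex"
  assumes "\<And>j s. j < n \<Longrightarrow> s \<in> {0<..<b} \<Longrightarrow> (f j has_vector_derivative f (Suc j) s) (at s)"
    and "\<And>j. j < n \<Longrightarrow> (f j \<longlongrightarrow> 0) (at_right 0)"
    and "\<And>s. s \<in> {0<..<b} \<Longrightarrow> norm (f n s) \<le> M"
    and "s \<in> {0<..<b}"
  shows "norm (f 0 s) \<le> M * s ^ n"
  using assms
proof (induction n arbitrary: f s)
  case 0
  then show ?case by simp
next
  case (Suc n)
  have M: "0 \<le> M" using Suc.prems(3)[OF Suc.prems(4)] norm_ge_zero order_trans by blast
  have b1: "norm (f (Suc 0) r) \<le> M * r ^ n" if "r \<in> {0<..<b}" for r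
    using Suc.IH[of "\<lambda>j. f (Suc j)" r] Suc.prems that by auto
  have le: "norm (f 0 s - f 0 r) \<le> M * s ^ Suc n" if r: "r \<in> {0<..<s}" for r
  proof -
    have "norm (f 0 s - f 0 r) \<le> (M * s ^ n) * norm (s - r)"
    proof (rule differentiable_bound[where S = "{r..s}"])
      fix q assume q: "q \<in> {r..s}"
      then have q': "q \<in> {0<..<b}" using r Suc.prems(4) by auto
      show "(f 0 has_derivative (\<lambda>h. h *\<^sub>R f (Suc 0) q)) (at q within {r..s})"
        using has_vector_derivative_at_within[OF Suc.prems(1)[OF zero_less_Suc q']]
        by (simp add: has_vector_derivative_def)
      have "M * q ^ n \<le> M * s ^ n"
        using q q' M by (intro mult_left_mono power_mono) auto
      then show "onorm (\<lambda>h. h *\<^sub>R f (Suc 0) q) \<le> M * s ^ n"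
        using b1[OF q'] by (simp add: onorm_scaleR_left[OF bounded_linear_ident] onorm_id)
    qed (use r in auto)
    also have "\<dots> \<le> M * s ^ n * s" using M r by (intro mult_left_mono) auto
    finally show ?thesis by (simp add: mult_ac)
  qed
  have "((\<lambda>r. norm (f 0 s - f 0 r)) \<longlongrightarrow> norm (f 0 s - 0)) (at_right 0)"
    by (intro tendsto_intros Suc.prems(2)) simp
  then have "norm (f 0 s - 0) \<le> M * s ^ Suc n"
    by (rule tendsto_upperbound)
      (use le Suc.prems(4) eventually_at_right_real[of 0 s] in \<open>auto elim!: eventually_mono\<close>)
  then show ?case by simp
qed

section \<open>The outer normal of a convex domain\<close>

lemma GDERIV_unique:
  assumes "GDERIV f x :> g" "GDERIV f x :> g'"
  shows "g = g'"
proof -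
  have "(\<lambda>h. h \<bullet> g) = (\<lambda>h. h \<bullet> g')"
    using assms unfolding gderiv_def by (rule has_derivative_unique)
  then show ?thesis by (metis vector_eq_ldot)
qed

lemma GDERIV_directional:
  assumes "GDERIV r x :> g"
  shows "((\<lambda>s. r (x + s *\<^sub>R v)) has_real_derivative v \<bullet> g) (at 0)"
proof -
  have "((\<lambda>s::real. x + s *\<^sub>R v) has_derivative (\<lambda>s. s *\<^sub>R v)) (at 0)"
    by (auto intro!: derivative_eq_intros)
  moreover have "(r has_derivative (\<lambda>h. h \<bullet> g)) (at (x + 0 *\<^sub>R v))"
    using assms by (simp add: gderiv_def)
  ultimately have "((\<lambda>s. r (x + s *\<^sub>R v)) has_derivative (\<lambda>s. (s *\<^sub>R v) \<bullet> g)) (at 0)"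
    by (rule has_derivative_compose)
  then show ?thesis by (simp add: has_field_derivative_def mult_commute_abs)
qed

lemma eventually_ray_in_open:
  fixes x v :: "'a::real_normed_vector"
  assumes "open U" "x \<in> U"
  shows "\<forall>\<^sub>F s in at_right (0::real). x + s *\<^sub>R v \<in> U"
proof -
  have "((\<lambda>s. x + s *\<^sub>R v) \<longlongrightarrow> x + 0 *\<^sub>R v) (at_right (0::real))"
    by (intro tendsto_add tendsto_scaleR tendsto_const tendsto_ident_at)
  then show ?thesis using assms by (auto intro: topological_tendstoD)
qed

lemma local_defining_function_gradient_nonzero:
  assumes "local_defining_function D x U r" "GDERIV r x :> g"
  shows "g \<noteq> 0"
  using assms GDERIV_unique unfolding local_defining_function_def by blast

lemma local_defining_function_boundary:
  assumes "open D" "x \<in> frontier D" "local_defining_function D x U r"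
  shows "r x = 0"
proof (rule antisym)
  have U: "open U" "x \<in> U" "D \<inter> U = {y \<in> U. r y < 0}"
    using assms(3) by (auto simp: local_defining_function_def)
  have xD: "x \<notin> D" "x \<in> closure D"
    using assms(1,2) by (auto simp: frontier_def interior_open)
  then show "0 \<le> r x" using U by force
  obtain g where "GDERIV r x :> g" using assms(3) by (auto simp: local_defining_function_def)
  then have "isCont r x" unfolding gderiv_def by (rule has_derivative_continuous)
  then have lim: "(r \<longlongrightarrow> r x) (at x within D)"
    using continuous_at_imp_continuous_at_within continuous_within by blast
  have "at x within D \<noteq> bot"
    using xD by (simp add: trivial_limit_within closure_def)
  moreover have "\<forall>\<^sub>F y in at x within D. r y \<le> 0"
  proof -
    have "\<forall>\<^sub>F y in at x within D. y \<in> U"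
    using topological_tendstoD[OF tendsto_ident_at U(1,2)] .
    moreover have "\<forall>\<^sub>F y in at x within D. y \<in> D" by (simp add: eventually_at_filter)
    ultimately show ?thesis
    proof eventually_elim
      case (elim y)
      then have "y \<in> D \<inter> U" by simp
      then show ?case unfolding U(3) by simp
    qed
  qed
  ultimately show "r x \<le> 0" using tendsto_upperbound[OF lim] by blast
qed

text \<open>
  Moving from \<open>x\<close> towards a point of \<open>D\<close> stays in \<open>D\<close> by convexity, where \<open>r < 0 \<le> r x\<close>; so \<open>r\<close> cannot
  increase to first order, and \<open>\<langle>g, y - x\<rangle> \<le> 0\<close>. Equality is excluded because \<open>y\<close> can be shifted a
  little in the direction of \<open>g\<close> without leaving the open set \<open>D\<close>.
\<close>

lemma local_defining_function_gradient_separates: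
  assumes "open D" "convex D" "x \<in> frontier D"
    and r: "local_defining_function D x U r" and g: "GDERIV r x :> g"
    and y: "y \<in> D"
  shows "g \<bullet> (y - x) < 0"
proof -
  have U: "open U" "x \<in> U" "D \<inter> U = {y \<in> U. r y < 0}"
    using r by (auto simp: local_defining_function_def)
  have "g \<noteq> 0" using local_defining_function_gradient_nonzero[OF r g] .
  have xD: "x \<notin> D" "x \<in> closure D"
    using assms(1,3) by (auto simp: frontier_def interior_open)
  then have rx: "r x \<ge> 0" using U by force
  have le: "g \<bullet> (z - x) \<le> 0" if z: "z \<in> D" for z
  proof (rule ccontr)
    assume "\<not> ?thesis"
    then have pos: "0 < (z - x) \<bullet> g" by (simp add: inner_commute)
    have d: "((\<lambda>s. r (x + s *\<^sub>R (z - x))) has_real_derivative (z - x) \<bullet> g) (at 0)"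
      using g by (rule GDERIV_directional)
    obtain d where d: "d > 0" "\<And>h. 0 < h \<Longrightarrow> h < d \<Longrightarrow> r (x + 0 *\<^sub>R (z - x)) < r (x + (0 + h) *\<^sub>R (z - x))"
      using DERIV_pos_inc_right[OF d pos] by blast
    have "\<forall>\<^sub>F s in at_right 0. x + s *\<^sub>R (z - x) \<in> U"
      using U(1,2) by (rule eventually_ray_in_open)
    moreover have "\<forall>\<^sub>F s in at_right 0. s \<in> {0<..<min d 1}"
      using d by (intro eventually_at_right_real) auto
    ultimately have "\<forall>\<^sub>F s in at_right 0. x + s *\<^sub>R (z - x) \<in> U \<and> s \<in> {0<..<min d 1}"
      by (rule eventually_conj)
    then obtain s where elim: "x + s *\<^sub>R (z - x) \<in> U" "s \<in> {0<..<min d 1}"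
      using eventually_happens by force
    show False
    proof -
      have "x - s *\<^sub>R (x - z) \<in> interior D"
        using mem_interior_closure_convex_shrink[of D z x s] elim z assms xD
        by (auto simp: interior_open)
      then have "x + s *\<^sub>R (z - x) \<in> D"
        using interior_subset by (auto simp: algebra_simps)
      with elim U have "r (x + s *\<^sub>R (z - x)) < 0" by blast
      moreover have "r x < r (x + s *\<^sub>R (z - x))" using d(2)[of s] elim by auto
      ultimately show False using rx by linarith
    qed
  qed
  show ?thesis
  proof -
    obtain e where e: "e > 0" "cball y e \<subseteq> D" using \<open>open D\<close> y open_contains_cball by blast
    \<comment> \<open>The shifted point still satisfies the weak inequality, so the unshifted one has room to spare.\<close>
    have "y + e *\<^sub>R sgn g \<in> D" using e by (auto simp: dist_norm norm_sgn)
    from le[OF this] have "g \<bullet> (y - x) + e * (g \<bullet> sgn g) \<le> 0"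
      by (simp add: algebra_simps inner_add_right inner_diff_right)
    moreover have "g \<bullet> sgn g > 0"
      using \<open>g \<noteq> 0\<close> by (simp add: sgn_div_norm)
    ultimately show ?thesis using e by (smt (verit) mult_pos_pos)
  qed
qed

text \<open>
  The description of the normal as a definite object needs that the direction of the gradient is
  the same for every local defining function. A direction that makes an obtuse angle with
  one gradient leads into \<open>D\<close>, and so makes an obtuse angle with every other gradient as well. For
  distinct unit vectors \<open>n\<close> and \<open>n'\<close> this fails: \<open>n - n'\<close> makes an obtuse angle with \<open>n'\<close> and an acute
  one with \<open>n\<close>.
\<close>

lemma outer_normal_eq_sgn_gradient:
  assumes "open D" "convex D" "x \<in> frontier D"
    and r: "local_defining_function D x U r" and g: "GDERIV r x :> g"
  shows "outer_normal D x = sgn g"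
  unfolding outer_normal_def
proof (rule the_equality)
  show "\<exists>U r g'. local_defining_function D x U r \<and> GDERIV r x :> g' \<and> sgn g = sgn g'"
    using r g by blast
  have gradient_cone: "g2 \<bullet> v < 0"
    if 1: "local_defining_function D x U1 r1" "GDERIV r1 x :> g1"
    and 2: "local_defining_function D x U2 r2" "GDERIV r2 x :> g2"
    and v: "g1 \<bullet> v < 0" for U1 r1 g1 U2 r2 g2 v
  proof -
    have U1: "open U1" "x \<in> U1" "D \<inter> U1 = {y \<in> U1. r1 y < 0}"
      using 1(1) by (auto simp: local_defining_function_def)
    have "r1 x \<le> 0"
      using local_defining_function_boundary[OF assms(1,3) 1(1)] by simp
    have "((\<lambda>s. r1 (x + s *\<^sub>R v)) has_real_derivative v \<bullet> g1) (at 0)" "v \<bullet> g1 < 0"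
      using GDERIV_directional[OF 1(2), of v] v by (simp_all add: inner_commute)
    then obtain d where d: "d > 0" "\<And>h. 0 < h \<Longrightarrow> h < d \<Longrightarrow> r1 (x + (0 + h) *\<^sub>R v) < r1 (x + 0 *\<^sub>R v)"
      using DERIV_neg_dec_right by blast
    have "\<forall>\<^sub>F s in at_right 0. s \<in> {0<..<d}"
      using d(1) by (rule eventually_at_right_real)
    with eventually_ray_in_open[OF U1(1,2), of v] have "\<forall>\<^sub>F s in at_right (0::real). g2 \<bullet> v < 0"
    proof eventually_elim
      case (elim s)
      have "r1 (x + s *\<^sub>R v) < 0" using d(2)[of s] elim \<open>r1 x \<le> 0\<close> by simp
      then have "x + s *\<^sub>R v \<in> D" using elim U1 by blast
      then have "g2 \<bullet> (x + s *\<^sub>R v - x) < 0"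
        by (rule local_defining_function_gradient_separates[OF assms(1-3) 2])
      then show ?case using elim by (simp add: mult_less_0_iff)
    qed
    then show ?thesis by (simp add: trivial_limit_at_right_real)
  qed
  fix n assume "\<exists>U r g. local_defining_function D x U r \<and> GDERIV r x :> g \<and> n = sgn g"
  then obtain U' r' g' where 2: "local_defining_function D x U' r'" "GDERIV r' x :> g'"
    and n: "n = sgn g'" by blast
  have "g \<noteq> 0" using local_defining_function_gradient_nonzero[OF r g] .
  have "g' \<noteq> 0" using local_defining_function_gradient_nonzero[OF 2] .
  show "n = sgn g"
  proof (rule ccontr)
    assume ne: "n \<noteq> sgn g"
    have 1: "sgn g \<bullet> sgn g = 1" "n \<bullet> n = 1"
      using \<open>g \<noteq> 0\<close> \<open>g' \<noteq> 0\<close> by (simp_all add: n norm_sgn flip: norm_eq_1)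
    have "0 < (n - sgn g) \<bullet> (n - sgn g)" using ne by simp
    then have "sgn g \<bullet> n < 1" using 1 by (simp add: inner_diff inner_commute)
    then have "sgn g \<bullet> (n - sgn g) < 0" "n \<bullet> (n - sgn g) > 0"
      using 1 by (simp_all add: inner_diff_right inner_commute)
    then have "g \<bullet> (n - sgn g) < 0" "g' \<bullet> (n - sgn g) > 0"
      using \<open>g \<noteq> 0\<close> \<open>g' \<noteq> 0\<close>
      by (simp_all add: n sgn_div_norm zero_less_divide_iff divide_less_0_iff flip: divide_inverse_commute)
    then show False using gradient_cone[OF r g 2] by force
  qed
qed

lemma outer_normal_inner_neg:
  assumes "open D" "convex D" "smooth_boundary D" "x \<in> frontier D" "y \<in> D"
  shows "outer_normal D x \<bullet> (y - x) < 0"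
proof -
  obtain U r where r: "local_defining_function D x U r"
    using assms(3,4) by (auto simp: smooth_boundary_def)
  then obtain g where g: "GDERIV r x :> g" "g \<noteq> 0" by (auto simp: local_defining_function_def)
  have "sgn g \<bullet> (y - x) < 0"
    using local_defining_function_gradient_separates[OF assms(1,2,4) r g(1) assms(5)] g(2)
    by (simp add: sgn_div_norm divide_less_0_iff mult_less_0_iff)
  then show ?thesis using outer_normal_eq_sgn_gradient[OF assms(1,2,4) r g(1)] by simp
qed

section \<open>Restriction to a fixed direction\<close>

text \<open>
  The transport operator never differentiates in \<open>\<xi>\<close>. For a fixed unit vector \<open>\<xi>\<close> the functions are
  therefore regarded as functions of \<open>(t, x)\<close> alone; since \<open>sgn \<xi> = \<xi>\<close>, the homogeneous extension in
  \<open>\<xi>\<close> disappears.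
\<close>

definition slice :: "vec3 \<Rightarrow> (real \<Rightarrow> vec3 \<Rightarrow> vec3 \<Rightarrow> 'b) \<Rightarrow> real \<times> vec3 \<Rightarrow> 'b" where
  "slice \<xi> \<psi> p = \<psi> (fst p) (snd p) \<xi>"

definition Ck_slice :: "nat \<Rightarrow> vec3 set \<Rightarrow> vec3 \<Rightarrow> (real \<Rightarrow> vec3 \<Rightarrow> vec3 \<Rightarrow> 'b::real_normed_vector) \<Rightarrow> bool" where
  "Ck_slice j D \<xi> \<psi> \<longleftrightarrow> Ck_upto j (UNIV \<times> D) (UNIV \<times> closure D) (slice \<xi> \<psi>)"

lemma Ck_slice_of_Ck_RSD:
  assumes "open D" "Ck_RSD j D \<psi>" "\<xi> \<in> S2"
  shows "Ck_slice j D \<xi> \<psi>"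
proof -
  let ?l = "\<lambda>p::real \<times> vec3. (fst p, snd p, 0::vec3)"
  have "\<xi> \<noteq> 0" "sgn \<xi> = \<xi>" using assms(3) by (auto simp: sgn_div_norm)
  have 1: "bounded_linear ?l" by (intro bounded_linear_intros)
  have "Ck_upto j (UNIV \<times> D) (UNIV \<times> closure D) (\<lambda>p. (\<lambda>(t, x, \<xi>). \<psi> t x (sgn \<xi>)) ((0, 0, \<xi>) + ?l p))"
    by (rule Ck_upto_compose_affine[OF _ 1 _ _ _ assms(2)[unfolded Ck_RSD_def]])
      (use \<open>\<xi> \<noteq> 0\<close> assms(1) in \<open>auto intro!: open_Times\<close>)
  then show ?thesis
    by (simp add: Ck_slice_def slice_def[abs_def] \<open>sgn \<xi> = \<xi>\<close>)
qed

lemma Ck_slice_of_Ck_SD: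
  assumes "open D" "Ck_SD j D f" "\<xi> \<in> S2"
  shows "Ck_slice j D \<xi> (\<lambda>t. f)"
proof -
  let ?l = "\<lambda>p::real \<times> vec3. (snd p, 0::vec3)"
  have "\<xi> \<noteq> 0" "sgn \<xi> = \<xi>" using assms(3) by (auto simp: sgn_div_norm)
  have 1: "bounded_linear ?l" by (intro bounded_linear_intros)
  have "Ck_upto j (UNIV \<times> D) (UNIV \<times> closure D) (\<lambda>p. (\<lambda>(x, \<xi>). f x (sgn \<xi>)) ((0, \<xi>) + ?l p))"
    by (rule Ck_upto_compose_affine[OF _ 1 _ _ _ assms(2)[unfolded Ck_SD_def]])
      (use \<open>\<xi> \<noteq> 0\<close> assms(1) in \<open>auto intro!: open_Times\<close>)
  then show ?thesis
    by (simp add: Ck_slice_def slice_def[abs_def] \<open>sgn \<xi> = \<xi>\<close>)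
qed

lemma has_vector_derivative_along_line:
  assumes "(f has_derivative f') (at (a + s *\<^sub>R v))"
  shows "((\<lambda>s. f (a + s *\<^sub>R v)) has_vector_derivative f' v) (at s)"
proof -
  interpret f': bounded_linear f' using assms by (rule has_derivative_bounded_linear)
  have "((\<lambda>s. a + s *\<^sub>R v) has_derivative (\<lambda>s. s *\<^sub>R v)) (at s)"
    by (auto intro!: derivative_eq_intros)
  from has_derivative_compose[OF this assms] show ?thesis
    by (simp add: has_vector_derivative_def f'.scaleR)
qed

lemma Ck_slice_has_derivative:
  assumes "Ck_slice (Suc j) D \<xi> \<psi>" "x \<in> D"
  shows "(slice \<xi> \<psi> has_derivative frechet_derivative (slice \<xi> \<psi>) (at (t, x))) (at (t, x))"
  using Ck_upto_has_derivative[OF assms(1)[unfolded Ck_slice_def], of "(t, x)"] assms(2) by simp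

lemma time_deriv_has_vector_derivative:
  assumes "Ck_slice (Suc j) D \<xi> \<psi>" "x \<in> D"
  shows "((\<lambda>s. \<psi> s x \<xi>) has_vector_derivative time_deriv \<psi> t x \<xi>) (at t)"
    and "time_deriv \<psi> t x \<xi> = frechet_derivative (slice \<xi> \<psi>) (at (t, x)) (1, 0)"
proof -
  have "((\<lambda>s. slice \<xi> \<psi> ((0, x) + s *\<^sub>R (1, 0))) has_vector_derivative
      frechet_derivative (slice \<xi> \<psi>) (at (t, x)) (1, 0)) (at t)"
    by (rule has_vector_derivative_along_line) (simp add: Ck_slice_has_derivative[OF assms])
  then have d: "((\<lambda>s. \<psi> s x \<xi>) has_vector_derivative
      frechet_derivative (slice \<xi> \<psi>) (at (t, x)) (1, 0)) (at t)"
    by (simp add: slice_def)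
  then show "time_deriv \<psi> t x \<xi> = frechet_derivative (slice \<xi> \<psi>) (at (t, x)) (1, 0)"
    by (simp add: time_deriv_def vector_derivative_at)
  with d show "((\<lambda>s. \<psi> s x \<xi>) has_vector_derivative time_deriv \<psi> t x \<xi>) (at t)" by simp
qed

lemma ray_deriv_has_vector_derivative:
  assumes "Ck_slice (Suc j) D \<xi> \<psi>" "x + \<tau> *\<^sub>R \<xi> \<in> D"
  shows "((\<lambda>\<tau>. \<psi> t (x + \<tau> *\<^sub>R \<xi>) \<xi>) has_vector_derivative ray_deriv \<psi> t (x + \<tau> *\<^sub>R \<xi>) \<xi>) (at \<tau>)"
    and "ray_deriv \<psi> t (x + \<tau> *\<^sub>R \<xi>) \<xi> = frechet_derivative (slice \<xi> \<psi>) (at (t, x + \<tau> *\<^sub>R \<xi>)) (0, \<xi>)"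
proof -
  let ?d = "frechet_derivative (slice \<xi> \<psi>) (at (t, x + \<tau> *\<^sub>R \<xi>)) (0, \<xi>)"
  have "((\<lambda>s. slice \<xi> \<psi> ((t, x) + s *\<^sub>R (0, \<xi>))) has_vector_derivative ?d) (at \<tau>)"
    by (rule has_vector_derivative_along_line) (simp add: Ck_slice_has_derivative[OF assms])
  then have d: "((\<lambda>\<tau>. \<psi> t (x + \<tau> *\<^sub>R \<xi>) \<xi>) has_vector_derivative ?d) (at \<tau>)"
    by (simp add: slice_def)
  have "((\<lambda>s. slice \<xi> \<psi> ((t, x + \<tau> *\<^sub>R \<xi>) + s *\<^sub>R (0, \<xi>))) has_vector_derivative ?d) (at 0)"
    by (rule has_vector_derivative_along_line) (simp add: Ck_slice_has_derivative[OF assms])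
  then show "ray_deriv \<psi> t (x + \<tau> *\<^sub>R \<xi>) \<xi> = ?d"
    by (simp add: slice_def ray_deriv_def vector_derivative_at)
  with d show "((\<lambda>\<tau>. \<psi> t (x + \<tau> *\<^sub>R \<xi>) \<xi>) has_vector_derivative ray_deriv \<psi> t (x + \<tau> *\<^sub>R \<xi>) \<xi>) (at \<tau>)"
    by simp
qed

lemma Ck_slice_cong:
  assumes "open D" "Ck_upto j (UNIV \<times> D) (UNIV \<times> closure D) f"
    "\<And>t x. x \<in> D \<Longrightarrow> \<psi> t x \<xi> = f (t, x)"
  shows "Ck_slice j D \<xi> \<psi>"
  unfolding Ck_slice_def
  by (rule Ck_upto_cong[OF _ _ assms(2)]) (auto simp: slice_def assms(3) intro: open_Times assms(1))

lemma Ck_slice_time_deriv: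
  assumes "open D" "Ck_slice (Suc j) D \<xi> \<psi>"
  shows "Ck_slice j D \<xi> (time_deriv \<psi>)"
  by (rule Ck_slice_cong[OF assms(1) Ck_upto_directional[OF _ assms(2)[unfolded Ck_slice_def]]])
    (simp_all add: time_deriv_has_vector_derivative(2)[OF assms(2)] open_Times assms(1))

lemma Ck_slice_ray_deriv:
  assumes "open D" "Ck_slice (Suc j) D \<xi> \<psi>"
  shows "Ck_slice j D \<xi> (ray_deriv \<psi>)"
proof (rule Ck_slice_cong[OF assms(1) Ck_upto_directional[OF _ assms(2)[unfolded Ck_slice_def]]])
  show "ray_deriv \<psi> t x \<xi> = frechet_derivative (slice \<xi> \<psi>) (at (t, x)) (0, \<xi>)" if "x \<in> D" for t x
    using ray_deriv_has_vector_derivative(2)[OF assms(2), of x 0] that by simp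
qed (simp add: open_Times assms(1))

lemma Ck_slice_transport_op:
  assumes "open D" "Ck_slice (Suc j) D \<xi> \<psi>" "Ck_slice j D \<xi> (\<lambda>t. \<alpha>)"
  shows "Ck_slice j D \<xi> (transport_op \<alpha> \<psi>)"
proof (rule Ck_slice_cong[OF assms(1)])
  have o: "open ((UNIV :: real set) \<times> D)" by (simp add: open_Times assms(1))
  show "Ck_upto j (UNIV \<times> D) (UNIV \<times> closure D)
      (\<lambda>p. slice \<xi> (time_deriv \<psi>) p + slice \<xi> (ray_deriv \<psi>) p + slice \<xi> (\<lambda>t. \<alpha>) p * slice \<xi> \<psi> p)"
    using Ck_slice_time_deriv[OF assms(1,2)] Ck_slice_ray_deriv[OF assms(1,2)] assms(3)
      Ck_upto_Suc_imp[OF assms(2)[unfolded Ck_slice_def]]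
    unfolding Ck_slice_def by (intro Ck_upto_add[OF o] Ck_upto_mult[OF o])
qed (simp add: slice_def transport_op_def)

text \<open>
  An operator of first order costs one derivative per application. The hypothesis is restricted to
  \<open>i < n\<close> because the coefficient \<open>\<alpha>\<close> of the transport operator has itself only finitely many derivatives.
\<close>

lemma Ck_slice_funpow:
  fixes T :: "(real \<Rightarrow> vec3 \<Rightarrow> vec3 \<Rightarrow> complex) \<Rightarrow> real \<Rightarrow> vec3 \<Rightarrow> vec3 \<Rightarrow> complex"
  assumes "\<And>i \<psi>. i < n \<Longrightarrow> Ck_slice (Suc i) D \<xi> \<psi> \<Longrightarrow> Ck_slice i D \<xi> (T \<psi>)"
    and "Ck_slice n D \<xi> \<psi>" "j \<le> n"
  shows "Ck_slice (n - j) D \<xi> ((T ^^ j) \<psi>)"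
  using assms(3)
proof (induction j)
  case 0
  then show ?case using assms(2) by simp
next
  case (Suc j)
  then have "Ck_slice (Suc (n - Suc j)) D \<xi> ((T ^^ j) \<psi>)" by (simp add: Suc_diff_Suc)
  then show ?case using assms(1)[of "n - Suc j"] Suc.prems by simp
qed

section \<open>Solutions along a characteristic\<close>

text \<open>
  Joint differentiability in \<open>(t, x)\<close> turns the sum of the two partial derivatives into the
  derivative along the direction \<open>(1, \<xi>)\<close>.
\<close>

lemma transport_op_along_characteristic:
  assumes "Ck_slice (Suc j) D \<xi> \<psi>" "x + s *\<^sub>R \<xi> \<in> D"
  shows "((\<lambda>s. \<psi> (t + s) (x + s *\<^sub>R \<xi>) \<xi>) has_vector_derivative
    transport_op \<alpha> \<psi> (t + s) (x + s *\<^sub>R \<xi>) \<xi>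
    - \<alpha> (x + s *\<^sub>R \<xi>) \<xi> * \<psi> (t + s) (x + s *\<^sub>R \<xi>) \<xi>) (at s)"
proof -
  let ?f' = "frechet_derivative (slice \<xi> \<psi>) (at (t + s, x + s *\<^sub>R \<xi>))"
  have d: "(slice \<xi> \<psi> has_derivative ?f') (at (t + s, x + s *\<^sub>R \<xi>))"
    by (rule Ck_slice_has_derivative[OF assms])
  then interpret f': bounded_linear ?f' by (rule has_derivative_bounded_linear)
  have "((\<lambda>s. slice \<xi> \<psi> ((t, x) + s *\<^sub>R (1, \<xi>))) has_vector_derivative ?f' (1, \<xi>)) (at s)"
    by (rule has_vector_derivative_along_line) (simp add: d)
  moreover have "?f' (1, \<xi>) = ?f' (1, 0) + ?f' (0, \<xi>)"
    by (simp flip: f'.add)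
  ultimately show ?thesis
    by (simp add: slice_def transport_op_def time_deriv_has_vector_derivative(2)[OF assms]
      ray_deriv_has_vector_derivative(2)[OF assms])
qed

text \<open>
  With the integrating factor \<open>E\<close>, the functions \<open>h j = E * (\<partial>\<^sub>t + H + \<alpha>)^j \<phi>\<close> on the line satisfy
  \<open>h j' = h (j + 1)\<close> and \<open>h (k + 1) = 0\<close>. So \<open>h 0\<close> is a polynomial of degree at most \<open>k\<close>,
  and it inherits the bound \<open>O(s^(k+1))\<close> from \<open>\<phi>\<close>.
\<close>

lemma transport_solution_zero_along_characteristic:
  fixes \<phi> :: "real \<Rightarrow> vec3 \<Rightarrow> vec3 \<Rightarrow> complex"
  assumes "open D" and \<phi>: "Ck_slice (Suc k) D \<xi> \<phi>" and \<alpha>: "Ck_slice k D \<xi> (\<lambda>t. \<alpha>)"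
    and eq: "\<And>t x. x \<in> D \<Longrightarrow> (transport_op \<alpha> ^^ Suc k) \<phi> t x \<xi> = 0"
    and cl: "\<And>s. s \<in> {0..b} \<Longrightarrow> x + s *\<^sub>R \<xi> \<in> closure D"
    and D: "\<And>s. s \<in> {0<..<b} \<Longrightarrow> x + s *\<^sub>R \<xi> \<in> D"
    and small: "\<And>s. s \<in> {0<..<b} \<Longrightarrow> norm (\<phi> (t + s) (x + s *\<^sub>R \<xi>) \<xi>) \<le> C * s ^ Suc k"
    and s: "s \<in> {0<..<b}"
  shows "\<phi> (t + s) (x + s *\<^sub>R \<xi>) \<xi> = 0"
proof -
  obtain a' where a': "continuous_on (UNIV \<times> closure D) a'"
    "\<And>p. p \<in> UNIV \<times> D \<Longrightarrow> a' p = slice \<xi> (\<lambda>t. \<alpha>) p"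
    using Ck_upto_extension[OF \<alpha>[unfolded Ck_slice_def]] by blast
  \<comment> \<open>The continuous extension is integrated instead of the coefficient itself: continuity on
    the closed interval makes the integrating factor bounded up to the base point.\<close>
  define a where "a s = a' (0, x + s *\<^sub>R \<xi>)" for s
  have a_cont: "continuous_on {0..b} a"
    unfolding a_def by (rule continuous_on_compose2[OF a'(1)]) (use cl in \<open>auto intro!: continuous_intros\<close>)
  have a_eq: "a s = \<alpha> (x + s *\<^sub>R \<xi>) \<xi>" if "s \<in> {0<..<b}" for s
    using a'(2)[of "(0, x + s *\<^sub>R \<xi>)"] D[OF that] by (simp add: a_def slice_def)
  define E where "E s = exp (integral {0..s} a)" for s
  have E: "(E has_vector_derivative a s * E s) (at s within {0..b})" if "s \<in> {0..b}" for s
    unfolding E_def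
    using field_vector_diff_chain_within[OF integral_has_vector_derivative[OF a_cont that]
        DERIV_subset[OF DERIV_exp]] by (simp add: o_def)
  have "continuous_on {0..b} E"
    using E has_vector_derivative_continuous continuous_on_eq_continuous_within by blast
  then have "bounded (E ` {0..b})"
    by (intro compact_imp_bounded compact_continuous_image) auto
  then obtain K where K: "\<And>s. s \<in> {0..b} \<Longrightarrow> norm (E s) \<le> K"
    unfolding bounded_iff by blast
  define h where "h j s = E s * (transport_op \<alpha> ^^ j) \<phi> (t + s) (x + s *\<^sub>R \<xi>) \<xi>" for j s
  have "h 0 s = 0"
  proof (rule iterated_derivative_zero_and_small_imp_zero[where n = "Suc k" and b = b and C = "K * C"])
    fix j r assume j: "j < Suc k" and r: "r \<in> {0<..<b}"
    let ?\<psi> = "(transport_op \<alpha> ^^ j) \<phi>"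
    have "Ck_slice (Suc k - j) D \<xi> ?\<psi>"
    proof (rule Ck_slice_funpow[OF _ \<phi>])
      fix i and \<psi> :: "real \<Rightarrow> vec3 \<Rightarrow> vec3 \<Rightarrow> complex"
      assume i: "i < Suc k" and \<psi>: "Ck_slice (Suc i) D \<xi> \<psi>"
      have "Ck_slice i D \<xi> (\<lambda>t. \<alpha>)"
        using \<alpha> i unfolding Ck_slice_def by (auto intro: Ck_upto_mono)
      then show "Ck_slice i D \<xi> (transport_op \<alpha> \<psi>)"
        by (rule Ck_slice_transport_op[OF assms(1) \<psi>])
    qed (use j in simp)
    then have "Ck_slice (Suc (k - j)) D \<xi> ?\<psi>" using j by (simp add: Suc_diff_le)
    from transport_op_along_characteristic[OF this D[OF r], of t \<alpha>]
    have 1: "((\<lambda>s. ?\<psi> (t + s) (x + s *\<^sub>R \<xi>) \<xi>) has_vector_derivative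
      transport_op \<alpha> ?\<psi> (t + r) (x + r *\<^sub>R \<xi>) \<xi>
      - a r * ?\<psi> (t + r) (x + r *\<^sub>R \<xi>) \<xi>) (at r)"
      by (simp add: a_eq[OF r])
    have 2: "(E has_vector_derivative a r * E r) (at r)"
      using E[of r] r by (simp add: at_within_Icc_at)
    show "(h j has_vector_derivative h (Suc j) r) (at r)"
      unfolding h_def using has_vector_derivative_mult[OF 2 1] by (simp add: algebra_simps)
  next
    fix r assume r: "r \<in> {0<..<b}"
    show "h (Suc k) r = 0" using eq[OF D[OF r]] by (simp add: h_def)
    have "norm (h 0 r) \<le> K * (C * r ^ Suc k)"
      unfolding h_def norm_mult using K[of r] small[OF r] r
      by (intro mult_mono) (auto intro: order_trans[OF norm_ge_zero])
    then show "norm (h 0 r) \<le> K * C * r ^ Suc k" by (simp add: mult.assoc)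
  qed (rule s)
  then show ?thesis by (simp add: h_def E_def)
qed

section \<open>Smallness near the base point\<close>

lemma Ck_slice_bounded_on_ray:
  assumes "Ck_slice j D \<xi> \<psi>"
    and cl: "\<And>s. s \<in> {0..b} \<Longrightarrow> x + s *\<^sub>R \<xi> \<in> closure D"
    and D: "\<And>s. s \<in> {0<..<b} \<Longrightarrow> x + s *\<^sub>R \<xi> \<in> D"
  obtains M where "\<And>t s. t \<in> {t0..t1} \<Longrightarrow> s \<in> {0<..<b} \<Longrightarrow> norm (\<psi> t (x + s *\<^sub>R \<xi>) \<xi>) \<le> M"
proof -
  obtain g where g: "continuous_on (UNIV \<times> closure D) g"
    "\<And>p. p \<in> UNIV \<times> D \<Longrightarrow> g p = slice \<xi> \<psi> p"
    using Ck_upto_extension[OF assms(1)[unfolded Ck_slice_def]] by blast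
  have "continuous_on ({t0..t1} \<times> {0..b}) (\<lambda>p. g (fst p, x + snd p *\<^sub>R \<xi>))"
    by (rule continuous_on_compose2[OF g(1)]) (use cl in \<open>auto intro!: continuous_intros\<close>)
  then have "bounded ((\<lambda>p. g (fst p, x + snd p *\<^sub>R \<xi>)) ` ({t0..t1} \<times> {0..b}))"
    by (intro compact_imp_bounded compact_continuous_image compact_Times) auto
  then obtain M where M: "\<And>p. p \<in> {t0..t1} \<times> {0..b} \<Longrightarrow> norm (g (fst p, x + snd p *\<^sub>R \<xi>)) \<le> M"
    unfolding bounded_iff by blast
  show ?thesis
  proof (rule that)
    fix t s assume "t \<in> {t0..t1}" "s \<in> {0<..<b}"
    then show "norm (\<psi> t (x + s *\<^sub>R \<xi>) \<xi>) \<le> M"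
      using M[of "(t, s)"] g(2)[of "(t, x + s *\<^sub>R \<xi>)"] D[of s] by (simp add: slice_def)
  qed
qed

text \<open>
  For each \<open>s\<close> the point \<open>x + s \<xi>\<close> is held fixed and Taylor's estimate is applied in time, from \<open>0\<close> to \<open>s\<close>.
  The constant does not depend on \<open>s\<close>, because the highest time derivative is bounded on the whole
  compact rectangle of times and ray points.
\<close>

lemma small_near_initial_time:
  fixes \<phi> :: "real \<Rightarrow> vec3 \<Rightarrow> vec3 \<Rightarrow> complex"
  assumes "open D" and \<phi>: "Ck_slice n D \<xi> \<phi>"
    and init: "\<And>j x. j < n \<Longrightarrow> x \<in> D \<Longrightarrow> (time_deriv ^^ j) \<phi> 0 x \<xi> = 0"
    and cl: "\<And>s. s \<in> {0..b} \<Longrightarrow> x + s *\<^sub>R \<xi> \<in> closure D"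
    and D: "\<And>s. s \<in> {0<..<b} \<Longrightarrow> x + s *\<^sub>R \<xi> \<in> D"
  obtains C where "\<And>s. s \<in> {0<..<b} \<Longrightarrow> norm (\<phi> s (x + s *\<^sub>R \<xi>) \<xi>) \<le> C * s ^ n"
proof -
  have C: "Ck_slice (n - j) D \<xi> ((time_deriv ^^ j) \<phi>)" if "j \<le> n" for j
    by (rule Ck_slice_funpow[OF _ \<phi> that]) (rule Ck_slice_time_deriv[OF \<open>open D\<close>])
  obtain M where M: "\<And>t s. t \<in> {0..b} \<Longrightarrow> s \<in> {0<..<b} \<Longrightarrow>
      norm ((time_deriv ^^ n) \<phi> t (x + s *\<^sub>R \<xi>) \<xi>) \<le> M"
    using Ck_slice_bounded_on_ray[OF C[OF order_refl] cl D] by blast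
  show ?thesis
  proof (rule that)
    fix s assume s: "s \<in> {0<..<b}"
    have d: "((\<lambda>t. (time_deriv ^^ j) \<phi> t (x + s *\<^sub>R \<xi>) \<xi>) has_vector_derivative
        (time_deriv ^^ Suc j) \<phi> t (x + s *\<^sub>R \<xi>) \<xi>) (at t)" if "j < n" for j t
      using time_deriv_has_vector_derivative(1)[of "n - Suc j" D \<xi> "(time_deriv ^^ j) \<phi>"]
        C[of j] that D[OF s] by (simp add: Suc_diff_Suc)
    have "norm ((time_deriv ^^ 0) \<phi> s (x + s *\<^sub>R \<xi>) \<xi>) \<le> M * s ^ n"
    proof (rule norm_le_power_of_vanishing_derivatives[where b = b and
          f = "\<lambda>j t. (time_deriv ^^ j) \<phi> t (x + s *\<^sub>R \<xi>) \<xi>"])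
      fix j assume j: "j < n"
      have "continuous (at 0) (\<lambda>t. (time_deriv ^^ j) \<phi> t (x + s *\<^sub>R \<xi>) \<xi>)"
        using has_vector_derivative_continuous[OF d[OF j]] .
      then have "((\<lambda>t. (time_deriv ^^ j) \<phi> t (x + s *\<^sub>R \<xi>) \<xi>) \<longlongrightarrow> 0) (at 0)"
        using init[OF j D[OF s]] by (simp add: continuous_at)
      then show "((\<lambda>t. (time_deriv ^^ j) \<phi> t (x + s *\<^sub>R \<xi>) \<xi>) \<longlongrightarrow> 0) (at_right 0)"
        using filterlim_at_split by blast
    qed (use d s M in auto)
    then show "norm (\<phi> s (x + s *\<^sub>R \<xi>) \<xi>) \<le> M * s ^ n" by simp
  qed
qed

text \<open>
  A boundary value is a limit over all approaches from \<open>D\<close>, and a formal limit that fails to exist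
  carries no information. The continuous extension to \<open>closure D\<close> guarantees existence, so that the
  limit along the ray is the same value.
\<close>

lemma boundary_value_limit_along_ray:
  assumes \<psi>: "Ck_slice j D \<xi> \<psi>" and x: "x \<in> closure D" "x \<notin> D"
    and D: "\<And>s. s \<in> {0<..<b} \<Longrightarrow> x + s *\<^sub>R \<xi> \<in> D" and "0 < b"
  shows "((\<lambda>s. \<psi> t (x + s *\<^sub>R \<xi>) \<xi>) \<longlongrightarrow> boundary_value D \<psi> t x \<xi>) (at_right 0)"
proof -
  obtain g where g: "continuous_on (UNIV \<times> closure D) g"
    "\<And>p. p \<in> UNIV \<times> D \<Longrightarrow> g p = slice \<xi> \<psi> p"
    using Ck_upto_extension[OF \<psi>[unfolded Ck_slice_def]] by blast
  have "continuous_on (closure D) (\<lambda>y. g (t, y))"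
    by (rule continuous_on_compose2[OF g(1)]) (auto intro!: continuous_intros)
  then have "((\<lambda>y. g (t, y)) \<longlongrightarrow> g (t, x)) (at x within closure D)"
    using x(1) by (simp add: continuous_on_def)
  then have "((\<lambda>y. g (t, y)) \<longlongrightarrow> g (t, x)) (at x within D)"
    using closure_subset by (rule tendsto_within_subset)
  moreover have "\<forall>\<^sub>F y in at x within D. g (t, y) = \<psi> t y \<xi>"
    by (auto simp: eventually_at_filter g(2) slice_def)
  ultimately have lim: "((\<lambda>y. \<psi> t y \<xi>) \<longlongrightarrow> g (t, x)) (at x within D)"
    by (rule Lim_transform_eventually)
  \<comment> \<open>Uniqueness of the limit requires that the boundary point is not isolated.\<close>
  have "at x within D \<noteq> bot"
    using x by (simp add: trivial_limit_within closure_def)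
  then have bv: "boundary_value D \<psi> t x \<xi> = g (t, x)"
    unfolding boundary_value_def using lim by (rule tendsto_Lim)
  have "filterlim (\<lambda>s. x + s *\<^sub>R \<xi>) (at x within D) (at_right 0)"
  proof -
    have "((\<lambda>s. x + s *\<^sub>R \<xi>) \<longlongrightarrow> x + 0 *\<^sub>R \<xi>) (at_right (0::real))"
      by (intro tendsto_intros)
    moreover have "\<forall>\<^sub>F s in at_right 0. x + s *\<^sub>R \<xi> \<in> D \<and> x + s *\<^sub>R \<xi> \<noteq> x"
      using eventually_at_right_real[OF \<open>0 < b\<close>]
    proof eventually_elim
      case (elim s)
      then show ?case using D[OF elim] x(2) by metis
    qed
    ultimately show ?thesis by (simp add: filterlim_at)
  qed
  from filterlim_compose[OF lim this] show ?thesis unfolding bv .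
qed

text \<open>
  Here the time \<open>t + s\<close> is held fixed, and the estimate runs along the ray from the boundary point \<open>x\<close>.
  The boundary condition is needed at the later times \<open>t + s\<close>, not at \<open>t\<close> itself.
\<close>

lemma small_near_inflow_boundary:
  fixes \<phi> :: "real \<Rightarrow> vec3 \<Rightarrow> vec3 \<Rightarrow> complex"
  assumes "open D" and \<phi>: "Ck_slice n D \<xi> \<phi>" and "0 \<le> t" and x: "x \<notin> D"
    and bdry: "\<And>j t. j < n \<Longrightarrow> 0 \<le> t \<Longrightarrow> boundary_value D ((ray_deriv ^^ j) \<phi>) t x \<xi> = 0"
    and cl: "\<And>s. s \<in> {0..b} \<Longrightarrow> x + s *\<^sub>R \<xi> \<in> closure D"
    and D: "\<And>s. s \<in> {0<..<b} \<Longrightarrow> x + s *\<^sub>R \<xi> \<in> D"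
  obtains C where "\<And>s. s \<in> {0<..<b} \<Longrightarrow> norm (\<phi> (t + s) (x + s *\<^sub>R \<xi>) \<xi>) \<le> C * s ^ n"
proof -
  have C: "Ck_slice (n - j) D \<xi> ((ray_deriv ^^ j) \<phi>)" if "j \<le> n" for j
    by (rule Ck_slice_funpow[OF _ \<phi> that]) (rule Ck_slice_ray_deriv[OF \<open>open D\<close>])
  obtain M where M: "\<And>r s. r \<in> {t..t + b} \<Longrightarrow> s \<in> {0<..<b} \<Longrightarrow>
      norm ((ray_deriv ^^ n) \<phi> r (x + s *\<^sub>R \<xi>) \<xi>) \<le> M"
    using Ck_slice_bounded_on_ray[OF C[OF order_refl] cl D] by blast
  show ?thesis
  proof (rule that)
    fix s assume s: "s \<in> {0<..<b}"
    have "norm ((ray_deriv ^^ 0) \<phi> (t + s) (x + s *\<^sub>R \<xi>) \<xi>) \<le> M * s ^ n"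
    proof (rule norm_le_power_of_vanishing_derivatives[where b = b and
          f = "\<lambda>j \<tau>. (ray_deriv ^^ j) \<phi> (t + s) (x + \<tau> *\<^sub>R \<xi>) \<xi>"])
      fix j assume j: "j < n"
      show "((\<lambda>\<tau>. (ray_deriv ^^ j) \<phi> (t + s) (x + \<tau> *\<^sub>R \<xi>) \<xi>) \<longlongrightarrow> 0) (at_right 0)"
        using boundary_value_limit_along_ray[OF C[of j] _ x D, of b "t + s"] bdry[OF j, of "t + s"]
          s cl[of 0] j \<open>0 \<le> t\<close> by simp
      fix \<tau> assume \<tau>: "\<tau> \<in> {0<..<b}"
      show "((\<lambda>\<tau>. (ray_deriv ^^ j) \<phi> (t + s) (x + \<tau> *\<^sub>R \<xi>) \<xi>) has_vector_derivative
          (ray_deriv ^^ Suc j) \<phi> (t + s) (x + \<tau> *\<^sub>R \<xi>) \<xi>) (at \<tau>)"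
        using ray_deriv_has_vector_derivative(1)[of "n - Suc j" D \<xi> "(ray_deriv ^^ j) \<phi>"]
          C[of j] j D[OF \<tau>] by (simp add: Suc_diff_Suc)
    qed (use s M in auto)
    then show "norm (\<phi> (t + s) (x + s *\<^sub>R \<xi>) \<xi>) \<le> M * s ^ n" by simp
  qed
qed

section \<open>Backward characteristics and uniqueness\<close>

text \<open>
  If the backward segment leaves \<open>D\<close>, it meets the frontier by connectedness. All points before the
  meeting point are inside, because the open segment from an interior point to a point of the
  closure of a convex set consists of interior points.
\<close>

lemma backward_ray_cases:
  fixes x v :: "'a::euclidean_space"
  assumes "open D" "convex D" "x \<in> D" "0 < t"
  obtains (initial) "\<And>s. s \<in> {0..t} \<Longrightarrow> x - s *\<^sub>R v \<in> D"
    | (inflow) \<sigma> where "\<sigma> \<in> {0<..t}" "x - \<sigma> *\<^sub>R v \<in> frontier D"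
      "\<And>s. s \<in> {0..<\<sigma>} \<Longrightarrow> x - s *\<^sub>R v \<in> D"
proof (cases "x - t *\<^sub>R v \<in> D")
  case True
  show ?thesis
  proof (rule initial)
    fix s assume "s \<in> {0..t}"
    then have "x - s *\<^sub>R v = (1 - s / t) *\<^sub>R x + (s / t) *\<^sub>R (x - t *\<^sub>R v)" "0 \<le> s / t" "s / t \<le> 1"
      using \<open>0 < t\<close> by (simp_all add: algebra_simps)
    then show "x - s *\<^sub>R v \<in> D"
      using convexD_alt[OF assms(2,3) True, of "s / t"] by simp
  qed
next
  case False
  have "connected ((\<lambda>s. x - s *\<^sub>R v) ` {0..t})"
    by (intro connected_continuous_image continuous_intros) simp
  moreover have "x - 0 *\<^sub>R v \<in> (\<lambda>s. x - s *\<^sub>R v) ` {0..t} \<inter> D"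
    using assms by (intro IntI imageI) auto
  moreover have "x - t *\<^sub>R v \<in> (\<lambda>s. x - s *\<^sub>R v) ` {0..t} - D"
    using assms False by (intro DiffI imageI) auto
  ultimately obtain \<sigma> where \<sigma>: "\<sigma> \<in> {0..t}" "x - \<sigma> *\<^sub>R v \<in> frontier D"
    using connected_Int_frontier by blast
  then have "\<sigma> \<noteq> 0" using assms by (auto simp: frontier_def interior_open)
  show ?thesis
  proof (rule inflow)
    show "\<sigma> \<in> {0<..t}" using \<sigma> \<open>\<sigma> \<noteq> 0\<close> by auto
    show "x - \<sigma> *\<^sub>R v \<in> frontier D" by (rule \<sigma>)
    fix s assume s: "s \<in> {0..<\<sigma>}"
    have "(x - \<sigma> *\<^sub>R v) - (1 - s / \<sigma>) *\<^sub>R ((x - \<sigma> *\<^sub>R v) - x) \<in> interior D"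
      by (rule mem_interior_closure_convex_shrink)
        (use assms \<sigma> s in \<open>auto simp: interior_open frontier_def divide_simps\<close>)
    moreover have "(x - \<sigma> *\<^sub>R v) - (1 - s / \<sigma>) *\<^sub>R ((x - \<sigma> *\<^sub>R v) - x) = x - s *\<^sub>R v"
    proof -
      have "(1 - s / \<sigma>) * \<sigma> = \<sigma> - s" using s by (simp add: field_simps)
      then show ?thesis by (simp add: algebra_simps flip: scaleR_add_left)
    qed
    ultimately have "x - s *\<^sub>R v \<in> interior D" by (simp only:)
    then show "x - s *\<^sub>R v \<in> D" using interior_subset by blast
  qed
qed

text \<open>
  The vanishing result concerns an open parameter interval. Continuing the ray a little beyond \<open>x\<close>
  makes \<open>x\<close> itself an inner point of that interval.
\<close>

lemma extend_ray_forward: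
  fixes x v :: "'a::euclidean_space"
  assumes "open D" "norm v = 1" "x \<in> D" and D: "\<And>s. s \<in> {0..<\<sigma>} \<Longrightarrow> x - s *\<^sub>R v \<in> D"
  obtains b where "\<sigma> < b" "\<And>s. s \<in> {0<..b} \<Longrightarrow> x - \<sigma> *\<^sub>R v + s *\<^sub>R v \<in> D"
proof -
  obtain e where e: "e > 0" "cball x e \<subseteq> D" using assms(1,3) open_contains_cball by blast
  show ?thesis
  proof (rule that)
    show "\<sigma> < \<sigma> + e" using e by simp
    fix s assume s: "s \<in> {0<..\<sigma> + e}"
    have eq: "x - \<sigma> *\<^sub>R v + s *\<^sub>R v = x - (\<sigma> - s) *\<^sub>R v" by (simp add: algebra_simps)
    show "x - \<sigma> *\<^sub>R v + s *\<^sub>R v \<in> D"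
    proof (cases "s \<le> \<sigma>")
      case True
      then show ?thesis unfolding eq using s by (intro D) auto
    next
      case False
      then have "x - (\<sigma> - s) *\<^sub>R v \<in> cball x e" using s assms(2) by (simp add: dist_norm)
      then show ?thesis unfolding eq using e by blast
    qed
  qed
qed

theorem theorem3p2:
  fixes D :: "vec3 set"
    and k :: nat
    and \<epsilon> \<rho> :: "vec3 \<Rightarrow> vec3 \<Rightarrow> real"
    and \<alpha> :: "vec3 \<Rightarrow> vec3 \<Rightarrow> complex"
    and \<phi> :: "real \<Rightarrow> vec3 \<Rightarrow> vec3 \<Rightarrow> complex"
  assumes "open D" and "D \<noteq> {}" and "bounded D" and "convex D" and "smooth_boundary D"
    and "Ck_SD k D \<epsilon>" and "Ck_SD k D \<rho>"
    and "bounded ((\<lambda>(x, \<xi>). \<epsilon> x \<xi>) ` (D \<times> S2))"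
    and "bounded ((\<lambda>(x, \<xi>). \<rho> x \<xi>) ` (D \<times> S2))"
    and "\<And>x \<xi>. x \<in> D \<Longrightarrow> \<xi> \<in> S2 \<Longrightarrow> \<epsilon> x \<xi> \<ge> 0"
    and "\<And>x \<xi>. \<alpha> x \<xi> = complex_of_real (\<epsilon> x \<xi>) + \<i> * complex_of_real (\<rho> x \<xi>)"
    and "Ck_RSD (k + 1) D \<phi>"
    and "\<And>t x \<xi>. x \<in> D \<Longrightarrow> \<xi> \<in> S2 \<Longrightarrow>
           1 / fact k * (transport_op \<alpha> ^^ (k + 1)) \<phi> t x \<xi> = 0"
    and "\<And>j x \<xi>. j \<le> k \<Longrightarrow> x \<in> D \<Longrightarrow> \<xi> \<in> S2 \<Longrightarrow> (time_deriv ^^ j) \<phi> 0 x \<xi> = 0"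
    and "\<And>j t x \<xi>. j \<le> k \<Longrightarrow> t \<ge> 0 \<Longrightarrow> x \<in> frontier D \<Longrightarrow> \<xi> \<in> S2 \<Longrightarrow>
           outer_normal D x \<bullet> \<xi> < 0 \<Longrightarrow> boundary_value D ((ray_deriv ^^ j) \<phi>) t x \<xi> = 0"
  shows "\<forall>t>0. \<forall>x\<in>D. \<forall>\<xi>\<in>S2. \<phi> t x \<xi> = 0"
proof (intro allI ballI impI)
  fix t :: real and x \<xi> :: vec3
  assume t: "0 < t" and x: "x \<in> D" and \<xi>: "\<xi> \<in> S2"
  have "norm \<xi> = 1" using \<xi> by simp
  have \<phi>: "Ck_slice (Suc k) D \<xi> \<phi>"
    using Ck_slice_of_Ck_RSD[OF \<open>open D\<close> \<open>Ck_RSD (k + 1) D \<phi>\<close> \<xi>] by simp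
  have \<alpha>: "Ck_slice k D \<xi> (\<lambda>t. \<alpha>)"
  proof (rule Ck_slice_cong[OF \<open>open D\<close>])
    have o: "open ((UNIV :: real set) \<times> D)" by (simp add: open_Times \<open>open D\<close>)
    note e = Ck_slice_of_Ck_SD[OF \<open>open D\<close> \<open>Ck_SD k D \<epsilon>\<close> \<xi>, unfolded Ck_slice_def]
    note r = Ck_slice_of_Ck_SD[OF \<open>open D\<close> \<open>Ck_SD k D \<rho>\<close> \<xi>, unfolded Ck_slice_def]
    show "Ck_upto k (UNIV \<times> D) (UNIV \<times> closure D)
        (\<lambda>p. complex_of_real (slice \<xi> (\<lambda>t. \<epsilon>) p) + \<i> * complex_of_real (slice \<xi> (\<lambda>t. \<rho>) p))"
      by (intro Ck_upto_add[OF o] Ck_upto_mult[OF o] Ck_upto_const[OF o]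
          Ck_upto_linear[OF o bounded_linear_of_real e] Ck_upto_linear[OF o bounded_linear_of_real r])
  qed (simp add: slice_def assms(11))
  have eq: "(transport_op \<alpha> ^^ Suc k) \<phi> t y \<xi> = 0" if "y \<in> D" for t y
    using assms(13)[OF that \<xi>, of t] by simp
  show "\<phi> t x \<xi> = 0"
    using \<open>open D\<close> \<open>convex D\<close> x t
  proof (cases rule: backward_ray_cases[where v = \<xi>])
    case initial
    obtain b where b: "t < b" "\<And>s. s \<in> {0<..b} \<Longrightarrow> x - t *\<^sub>R \<xi> + s *\<^sub>R \<xi> \<in> D"
      using extend_ray_forward[OF \<open>open D\<close> \<open>norm \<xi> = 1\<close> x, of t] initial by auto
    have D: "x - t *\<^sub>R \<xi> + s *\<^sub>R \<xi> \<in> D" if "s \<in> {0<..<b}" for s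
      using b(2) that by auto
    have cl: "x - t *\<^sub>R \<xi> + s *\<^sub>R \<xi> \<in> closure D" if "s \<in> {0..b}" for s
    proof (cases "s = 0")
      case True
      then show ?thesis using initial[of t] t closure_subset by auto
    next
      case False
      then show ?thesis using b(2)[of s] that closure_subset by auto
    qed
    obtain C where C: "\<And>s. s \<in> {0<..<b} \<Longrightarrow> norm (\<phi> s (x - t *\<^sub>R \<xi> + s *\<^sub>R \<xi>) \<xi>) \<le> C * s ^ Suc k"
      by (rule small_near_initial_time[OF \<open>open D\<close> \<phi> _ cl D]) (use assms(14) \<xi> in auto)
    have "\<phi> (0 + t) (x - t *\<^sub>R \<xi> + t *\<^sub>R \<xi>) \<xi> = 0"
      by (rule transport_solution_zero_along_characteristic[OF \<open>open D\<close> \<phi> \<alpha> eq cl D])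
        (use C b(1) t in auto)
    then show ?thesis by simp
  next
    case (inflow \<sigma>)
    let ?y = "x - \<sigma> *\<^sub>R \<xi>"
    obtain b where b: "\<sigma> < b" "\<And>s. s \<in> {0<..b} \<Longrightarrow> ?y + s *\<^sub>R \<xi> \<in> D"
      using extend_ray_forward[OF \<open>open D\<close> \<open>norm \<xi> = 1\<close> x inflow(3)] by metis
    have D: "?y + s *\<^sub>R \<xi> \<in> D" if "s \<in> {0<..<b}" for s
      using b(2) that by auto
    have y: "?y \<in> closure D" "?y \<notin> D"
      using inflow(2) \<open>open D\<close> by (auto simp: frontier_def interior_open)
    have cl: "?y + s *\<^sub>R \<xi> \<in> closure D" if "s \<in> {0..b}" for s
    proof (cases "s = 0")
      case True
      then show ?thesis using y by simp
    next
      case False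
      then show ?thesis using b(2)[of s] that closure_subset by auto
    qed
    have "outer_normal D ?y \<bullet> (x - ?y) < 0"
      using outer_normal_inner_neg[OF \<open>open D\<close> \<open>convex D\<close> \<open>smooth_boundary D\<close> inflow(2) x] .
    then have n: "outer_normal D ?y \<bullet> \<xi> < 0"
      using inflow(1) by (simp add: mult_less_0_iff)
    have bdry: "boundary_value D ((ray_deriv ^^ j) \<phi>) r ?y \<xi> = 0" if "j < Suc k" "0 \<le> r" for j r
      using assms(15)[of j r ?y \<xi>] that inflow(2) \<xi> n by simp
    have t0: "0 \<le> t - \<sigma>" using inflow(1) by simp
    obtain C where C: "\<And>s. s \<in> {0<..<b} \<Longrightarrow> norm (\<phi> (t - \<sigma> + s) (?y + s *\<^sub>R \<xi>) \<xi>) \<le> C * s ^ Suc k"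
      using small_near_inflow_boundary[OF \<open>open D\<close> \<phi> t0 y(2) bdry cl D] by blast
    have "\<phi> (t - \<sigma> + \<sigma>) (?y + \<sigma> *\<^sub>R \<xi>) \<xi> = 0"
      by (rule transport_solution_zero_along_characteristic[OF \<open>open D\<close> \<phi> \<alpha> eq cl D C])
        (use b(1) inflow(1) in auto)
    then show ?thesis by simp
  qed
qed

end
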